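(* Let $\beta\in\{3,4\}$ and let $H=[A_{s,t}]_{1\le s,t\le\beta}\in\mathbb{M}_{\beta n}^+$ be partitioned into $\beta\times\beta$ blocks $A_{s,t}\in\mathbb{M}_n$, all of which are Hermitian. Let $\Delta=\sum_{s=1}^{\beta}A_{s,s}$ be the sum of its diagonal blocks. Then $$\lambda_{1+4k}(H)\le\lambda_{1+k}(\Delta)$$ for all $k=0,\ldots,n-1$.
   Context: $\mathbb{M}_n$ is the algebra of $n\times n$ matrices with real or complex entries (the statement holds for either choice), and $\mathbb{M}_m^+$ is the set of positive semidefinite (Hermitian) matrices in $\mathbb{M}_m$. For $T\in\mathbb{M}_m^+$, $\lambda_j(T)$ denotes the $j$th eigenvalue of $T$ in decreasing order, counted with multiplicity, with the convention $\lambda_j(T)=0$ for $j>m$. *)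

theory Defs
  imports
    Complex_Main
    "HOL-Library.Multiset"
    "HOL-Computational_Algebra.Polynomial"
    "Jordan_Normal_Form.Schur_Decomposition"
begin

definition hermitian_mat :: "'a::conjugatable_field mat \<Rightarrow> bool" where
  "hermitian_mat A \<longleftrightarrow> mat_adjoint A = A"

text \<open>
  The form \<open>(A *\<^sub>v v) \<bullet>c v\<close> is \<open>v\<^sup>* A v\<close>.  For complex entries, \<open>0 \<le> z\<close> is the order of
  \<^theory>\<open>HOL-Library.Complex_Order\<close>: \<open>z\<close> is real and nonnegative.
\<close>

definition psd_mats :: "nat \<Rightarrow> 'a::conjugatable_ordered_field mat set" where
  "psd_mats m =
    {A \<in> carrier_mat m m. hermitian_mat A \<and> (\<forall>v \<in> carrier_vec m. 0 \<le> (A *\<^sub>v v) \<bullet>c v)}"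

text \<open>
  The eigenvalues of a Hermitian matrix are real, so over \<^typ>\<open>complex\<close> the inverse of
  \<^const>\<open>of_real\<close> merely reads them as elements of \<^typ>\<open>real\<close> (to sort them); over \<^typ>\<open>real\<close> it
  is the identity.  The multiset \<open>proots\<close> counts every root of the characteristic polynomial
  with its multiplicity.  The functions below are only meaningful for Hermitian matrices.
\<close>

definition eigvals_decr :: "'a::real_field mat \<Rightarrow> real list" where
  "eigvals_decr T =
    rev (sorted_list_of_multiset (image_mset (the_inv of_real) (proots (char_poly T))))"

text \<open>The index \<open>j\<close> starts at 1, as in \<open>\<lambda>\<^sub>1(T) \<ge> \<lambda>\<^sub>2(T) \<ge> \<dots>\<close>.\<close>

definition eigval :: "nat \<Rightarrow> 'a::real_field mat \<Rightarrow> real" where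
  "eigval j T = (if j \<le> dim_row T then eigvals_decr T ! (j - 1) else 0)"

text \<open>Block indices \<open>s\<close>, \<open>t\<close> start at 0, as matrix indices do.\<close>

definition block :: "nat \<Rightarrow> 'a mat \<Rightarrow> nat \<Rightarrow> nat \<Rightarrow> 'a mat" where
  "block n H s t = mat n n (\<lambda>(i, j). H $$ (s * n + i, t * n + j))"

definition diag_block_sum :: "nat \<Rightarrow> nat \<Rightarrow> 'a::comm_monoid_add mat \<Rightarrow> 'a mat" where
  "diag_block_sum \<beta> n H = mat n n (\<lambda>(i, j). \<Sum>s<\<beta>. block n H s s $$ (i, j))"

lemma proots_prod_linear:
  "proots (\<Prod>e\<leftarrow>es. [:- e, 1:]) = mset (es :: 'a::idom list)"
proof (induction es)
  case (Cons e es)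
  have "(\<Prod>e\<leftarrow>es. [:- e, 1:]) \<noteq> (0 :: 'a poly)"
    by (auto simp: prod_list_zero_iff)
  then have "proots (\<Prod>e\<leftarrow>e # es. [:- e, 1:]) = proots [:- e, 1:] + mset es"
    by (simp only: list.map prod_list.Cons, subst proots_mult) (auto simp: Cons.IH)
  moreover have "proots [:- e, 1:] = {#e#}"
    by simp
  ultimately show ?case
    by simp
qed simp

lemma eigvals_decr_eqI:
  fixes T :: "'a::real_field mat"
  assumes "char_poly T = (\<Prod>e\<leftarrow>es. [:- of_real e, 1:])" and "sorted_wrt (\<ge>) es"
  shows "eigvals_decr T = es"
proof -
  have "the_inv (of_real :: real \<Rightarrow> 'a) (of_real x) = x" for x
    by (rule the_inv_f_f) (auto intro: injI)
  moreover have "proots (char_poly T) = mset (map of_real es)"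
    using proots_prod_linear[of "map of_real es :: 'a list"] assms(1) by (simp add: o_def)
  ultimately have "image_mset (the_inv of_real) (proots (char_poly T)) = mset es"
    by (simp add: multiset.map_comp o_def)
  moreover have "sorted (rev es)"
    using assms(2) by (simp add: sorted_wrt_rev)
  ultimately show ?thesis
    unfolding eigvals_decr_def
    by (simp add: sorted_list_of_multiset_mset) (metis mset_rev rev_rev_ident sorted_sort_id sort_key_eq_sort_key properties_for_sort)
qed

end

theory Submission
  imports Defs
begin

text \<open>
  Factor \<open>H = C\<^sup>* C\<close> with \<open>C = [C\<^sub>1, \<dots>, C\<^sub>\<beta>]\<close>, so that \<open>A\<^sub>s\<^sub>t = C\<^sub>s\<^sup>* C\<^sub>t\<close>.  The blocks of \<open>H\<close>
  are Hermitian exactly when \<open>C\<^sub>s\<^sup>* C\<^sub>t = C\<^sub>t\<^sup>* C\<^sub>s\<close>.  There are four quaternion units, and as real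
  \<open>4 \<times> 4\<close> matrices \<open>q\<^sub>s\<close> (left multiplication) they are orthogonal and satisfy
  \<open>q\<^sub>s\<^sup>T q\<^sub>t + q\<^sub>t\<^sup>T q\<^sub>s = 0\<close> for \<open>s \<noteq> t\<close>.  Hence, for any signs \<open>\<epsilon>\<^sub>s\<close> and for
  \<open>Q\<^sub>\<epsilon> = \<Sum>\<^sub>s \<epsilon>\<^sub>s C\<^sub>s \<otimes> q\<^sub>s\<close>, the mixed terms of \<open>Q\<^sub>\<epsilon>\<^sup>* Q\<^sub>\<epsilon>\<close> cancel in pairs and
  \<open>Q\<^sub>\<epsilon>\<^sup>* Q\<^sub>\<epsilon> = \<Delta> \<otimes> I\<close> (\<open>clifford_sum_diagonal\<close>).  This is why \<open>\<beta>\<close> may be at most \<open>4\<close>.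
  In the other order, summing over the four sign rows of a Hadamard matrix removes the mixed terms:
  \<open>\<Sum>\<^sub>\<epsilon> Q\<^sub>\<epsilon> Q\<^sub>\<epsilon>\<^sup>* = 4 C C\<^sup>* \<otimes> I\<close> (\<open>sum_norm_sq_signed_quaternion\<close>), and \<open>C C\<^sup>*\<close> has the nonzero
  eigenvalues of \<open>H\<close>.

  The eigenvalue bound is then a dimension count (\<open>partial_trace_eigenvalue_bound\<close>).  Tensoring
  the span of the top \<open>4k + 1\<close> eigenvectors of \<open>C C\<^sup>*\<close> with the four-dimensional space gives
  \<open>16k + 4\<close> dimensions.  Requiring that each of the four vectors \<open>Q\<^sub>\<epsilon>\<^sup>* x\<close> be orthogonal to the top
  \<open>k\<close> eigenvectors of \<open>\<Delta>\<close> in each of the four coordinates costs \<open>16k\<close> linear equations.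
  So there is \<open>x \<noteq> 0\<close> with \<open>\<parallel>Q\<^sub>\<epsilon>\<^sup>* x\<parallel>\<^sup>2 \<le> \<lambda>\<^sub>1\<^sub>+\<^sub>k(\<Delta>) \<parallel>x\<parallel>\<^sup>2\<close> for every \<open>\<epsilon>\<close>
  (\<open>adjoint_norm_le_of_norm_le\<close>); averaging over \<open>\<epsilon>\<close> bounds the quadratic form of \<open>C C\<^sup>* \<otimes> I\<close> at
  \<open>x\<close>, which is at least \<open>\<lambda>\<^sub>1\<^sub>+\<^sub>4\<^sub>k(H) \<parallel>x\<parallel>\<^sup>2\<close>.

  The eigenbases come from the spectral theorem for Hermitian matrices, which is derived from the
  Schur triangular form.  A real symmetric matrix is treated as a complex one with the same
  characteristic polynomial.

  Since matrices of many different sizes meet here, the core works with entry functions and finite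
  sums rather than with matrices.
\<close>

section \<open>Gram matrices and homogeneous linear systems\<close>

text \<open>
  This is \<open>\<parallel>Q v\<parallel>\<^sup>2 = v\<^sup>* (Q\<^sup>* Q) v\<close>, weighted by \<open>g\<close>.  The norm computations below all reduce
  to it once the Gram matrix \<open>G\<close> is known.
\<close>

lemma sum_norm_sq_gram:
  fixes Q :: "'i \<Rightarrow> 'j \<Rightarrow> complex" and g :: "'i \<Rightarrow> real"
  assumes "\<And>j l. j \<in> J \<Longrightarrow> l \<in> J \<Longrightarrow>
    (\<Sum>i\<in>I. of_real (g i) * (cnj (Q i j) * Q i l)) = G j l"
  shows "complex_of_real (\<Sum>i\<in>I. g i * (cmod (\<Sum>j\<in>J. Q i j * v j))\<^sup>2)
       = (\<Sum>j\<in>J. \<Sum>l\<in>J. cnj (v j) * v l * G j l)"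
proof -
  have "complex_of_real (\<Sum>i\<in>I. g i * (cmod (\<Sum>j\<in>J. Q i j * v j))\<^sup>2)
      = (\<Sum>i\<in>I. of_real (g i) * (cnj (\<Sum>j\<in>J. Q i j * v j) * (\<Sum>l\<in>J. Q i l * v l)))"
    by (simp only: of_real_sum of_real_mult complex_norm_square mult.commute)
  also have "\<dots> = (\<Sum>i\<in>I. \<Sum>j\<in>J. \<Sum>l\<in>J.
      cnj (v j) * v l * (of_real (g i) * (cnj (Q i j) * Q i l)))"
    by (simp add: sum_product sum_distrib_left mult_ac)
  also have "\<dots> = (\<Sum>j\<in>J. \<Sum>l\<in>J. \<Sum>i\<in>I.
      cnj (v j) * v l * (of_real (g i) * (cnj (Q i j) * Q i l)))"
    by (subst sum.swap, intro sum.cong refl, rule sum.swap)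
  also have "\<dots> = (\<Sum>j\<in>J. \<Sum>l\<in>J. cnj (v j) * v l * G j l)"
    by (simp add: assms flip: sum_distrib_left)
  finally show ?thesis .
qed

lemma sum_norm_sq_gram_diagonal:
  fixes Q :: "'i \<Rightarrow> 'j \<Rightarrow> complex" and g :: "'i \<Rightarrow> real" and h :: "'j \<Rightarrow> real"
  assumes "finite J"
    and "\<And>j l. j \<in> J \<Longrightarrow> l \<in> J \<Longrightarrow>
      (\<Sum>i\<in>I. of_real (g i) * (cnj (Q i j) * Q i l)) = (if j = l then of_real (h j) else 0)"
  shows "(\<Sum>i\<in>I. g i * (cmod (\<Sum>j\<in>J. Q i j * v j))\<^sup>2) = (\<Sum>j\<in>J. h j * (cmod (v j))\<^sup>2)"
proof -
  have "complex_of_real (\<Sum>i\<in>I. g i * (cmod (\<Sum>j\<in>J. Q i j * v j))\<^sup>2)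
      = (\<Sum>j\<in>J. \<Sum>l\<in>J. cnj (v j) * v l * (if j = l then of_real (h j) else 0))"
    by (rule sum_norm_sq_gram) (rule assms(2))
  also have "\<dots> = (\<Sum>j\<in>J. cnj (v j) * v j * of_real (h j))"
    using \<open>finite J\<close> by (simp add: if_distrib[of "\<lambda>x. _ * x"] cong: if_cong)
  also have "\<dots> = complex_of_real (\<Sum>j\<in>J. h j * (cmod (v j))\<^sup>2)"
    by (simp only: of_real_sum of_real_mult complex_norm_square mult_ac)
  finally show ?thesis
    by (simp only: of_real_eq_iff)
qed

text \<open>
  With \<open>v = Q\<^sup>* x\<close> one has \<open>\<parallel>v\<parallel>\<^sup>2 = Re \<langle>x, Q v\<rangle>\<close>.  Expanding \<open>\<parallel>\<mu> x - Q v\<parallel>\<^sup>2 \<ge> 0\<close> and inserting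
  \<open>\<parallel>Q v\<parallel>\<^sup>2 \<le> \<mu> \<parallel>v\<parallel>\<^sup>2\<close> gives \<open>\<mu> \<parallel>v\<parallel>\<^sup>2 \<le> \<mu>\<^sup>2 \<parallel>x\<parallel>\<^sup>2\<close>.
  For \<open>\<mu> = 0\<close> the hypothesis says \<open>Q v = 0\<close>, hence \<open>v = 0\<close>.
\<close>

lemma adjoint_norm_le_of_norm_le:
  fixes Q :: "'i \<Rightarrow> 'j \<Rightarrow> complex"
  assumes "finite I" and "0 \<le> \<mu>"
    and v: "\<And>j. j \<in> J \<Longrightarrow> v j = (\<Sum>i\<in>I. cnj (Q i j) * x i)"
    and le: "(\<Sum>i\<in>I. (cmod (\<Sum>j\<in>J. Q i j * v j))\<^sup>2) \<le> \<mu> * (\<Sum>j\<in>J. (cmod (v j))\<^sup>2)"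
  shows "(\<Sum>j\<in>J. (cmod (v j))\<^sup>2) \<le> \<mu> * (\<Sum>i\<in>I. (cmod (x i))\<^sup>2)"
proof -
  define y where "y = (\<lambda>i. \<Sum>j\<in>J. Q i j * v j)"
  define V where "V = (\<Sum>j\<in>J. (cmod (v j))\<^sup>2)"
  define X where "X = (\<Sum>i\<in>I. (cmod (x i))\<^sup>2)"
  define Y where "Y = (\<Sum>i\<in>I. (cmod (y i))\<^sup>2)"
  have "complex_of_real V = (\<Sum>j\<in>J. cnj (v j) * v j)"
    by (simp only: V_def of_real_sum complex_norm_square mult.commute)
  also have "\<dots> = (\<Sum>j\<in>J. \<Sum>i\<in>I. cnj (x i) * (Q i j * v j))"
    by (intro sum.cong refl) (simp add: v[THEN arg_cong[of _ _ cnj]] sum_distrib_left mult_ac)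
  also have "\<dots> = (\<Sum>i\<in>I. cnj (x i) * y i)"
    by (subst sum.swap) (simp add: y_def sum_distrib_left)
  finally have "Re (complex_of_real V) = Re (\<Sum>i\<in>I. cnj (x i) * y i)"
    by (rule arg_cong)
  moreover define ip where "ip = (\<lambda>i. Re (cnj (x i) * y i))"
  ultimately have V: "V = (\<Sum>i\<in>I. ip i)"
    by simp
  have "Y \<le> \<mu> * V"
    using le by (simp add: Y_def y_def V_def)
  show ?thesis
  proof (cases "\<mu> = 0")
    case True
    have "0 \<le> Y"
      by (simp add: Y_def sum_nonneg)
    with \<open>Y \<le> \<mu> * V\<close> True have "(\<Sum>i\<in>I. (cmod (y i))\<^sup>2) = 0"
      by (simp add: Y_def)
    then have "V = 0"
      unfolding V ip_def using \<open>finite I\<close> by (simp add: sum_nonneg_eq_0_iff)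
    with True show ?thesis
      by (simp add: V_def)
  next
    case False
    have "(cmod (of_real \<mu> * x i - y i))\<^sup>2
        = \<mu>\<^sup>2 * (cmod (x i))\<^sup>2 - 2 * \<mu> * ip i + (cmod (y i))\<^sup>2" for i
      by (simp add: cmod_power2 ip_def) (simp add: power2_eq_square algebra_simps)
    then have "(\<Sum>i\<in>I. (cmod (of_real \<mu> * x i - y i))\<^sup>2) = \<mu>\<^sup>2 * X - 2 * \<mu> * V + Y"
      by (simp add: X_def V Y_def sum.distrib sum_subtractf sum_distrib_left)
    moreover have "0 \<le> (\<Sum>i\<in>I. (cmod (of_real \<mu> * x i - y i))\<^sup>2)"
      by (simp add: sum_nonneg)
    ultimately have "\<mu> * V \<le> \<mu> * (\<mu> * X)"
      using \<open>Y \<le> \<mu> * V\<close> by (simp add: power2_eq_square)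
    with False \<open>0 \<le> \<mu>\<close> show ?thesis
      by (simp add: X_def V_def)
  qed
qed

text \<open>
  Gaussian elimination, one equation per induction step: an equation with a nonzero coefficient at
  \<open>p\<close> is solved for the unknown \<open>p\<close>, which is then eliminated from the other equations.
\<close>

lemma underdetermined_system_solution:
  fixes M :: "'e \<Rightarrow> 'i \<Rightarrow> 'a::field"
  assumes "finite E" "finite X" "card E < card X"
  obtains x where "\<exists>i\<in>X. x i \<noteq> 0" "\<And>e. e \<in> E \<Longrightarrow> (\<Sum>i\<in>X. M e i * x i) = 0"
proof -
  have "\<exists>x. (\<exists>i\<in>X. x i \<noteq> 0) \<and> (\<forall>e\<in>E. (\<Sum>i\<in>X. M e i * x i) = 0)"
    using assms
  proof (induction E arbitrary: X M rule: finite_induct)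
    case empty
    then have "X \<noteq> {}"
      by auto
    then show ?case
      by (intro exI[of _ "\<lambda>_. 1"]) auto
  next
    case (insert e E)
    show ?case
    proof (cases "\<forall>i\<in>X. M e i = 0")
      case True
      have "card E < card X"
        using insert by simp
      then obtain x where "\<exists>i\<in>X. x i \<noteq> 0" "\<forall>f\<in>E. (\<Sum>i\<in>X. M f i * x i) = 0"
        using insert.IH[of X M] insert.prems by blast
      with True show ?thesis
        by (intro exI[of _ x]) auto
    next
      case False
      then obtain p where p: "p \<in> X" "M e p \<noteq> 0"
        by blast
      define M' where "M' = (\<lambda>f i. M f i - M f p * M e i / M e p)"
      have "card E < card (X - {p})"
        using insert p by simp
      then obtain x where x: "\<exists>i\<in>X - {p}. x i \<noteq> 0"
        and sol: "\<forall>f\<in>E. (\<Sum>i\<in>X - {p}. M' f i * x i) = 0"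
        using insert.IH[of "X - {p}" M'] insert.prems by blast
      define xp where "xp = - (\<Sum>i\<in>X - {p}. M e i * x i) / M e p"
      have split: "(\<Sum>i\<in>X. M f i * (x(p := xp)) i) = M f p * xp + (\<Sum>i\<in>X - {p}. M f i * x i)" for f
        using insert.prems(1) p(1) by (simp add: sum.remove[of X p])
      have "(\<Sum>i\<in>X. M f i * (x(p := xp)) i) = (\<Sum>i\<in>X - {p}. M' f i * x i)" for f
      proof -
        have "(\<Sum>i\<in>X - {p}. M' f i * x i)
            = (\<Sum>i\<in>X - {p}. M f i * x i) - (\<Sum>i\<in>X - {p}. M f p / M e p * (M e i * x i))"
          by (simp add: M'_def algebra_simps sum_subtractf)
        also have "(\<Sum>i\<in>X - {p}. M f p / M e p * (M e i * x i)) = - M f p * xp"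
          by (simp add: xp_def sum_distrib_left sum_divide_distrib sum_negf)
        finally show ?thesis
          unfolding split by simp
      qed
      moreover have "(\<Sum>i\<in>X. M e i * (x(p := xp)) i) = 0"
        unfolding split using p by (simp add: xp_def)
      ultimately have "\<forall>f\<in>insert e E. (\<Sum>i\<in>X. M f i * (x(p := xp)) i) = 0"
        using sol by simp
      moreover have "\<exists>i\<in>X. (x(p := xp)) i \<noteq> 0"
        using x by auto
      ultimately show ?thesis
        by blast
    qed
  qed
  with that show ?thesis
    by blast
qed

section \<open>Quaternion units and Hadamard signs\<close>

text \<open>
  Left multiplication by \<open>1\<close>, \<open>i\<close>, \<open>j\<close>, \<open>k\<close> on the quaternions, in the basis \<open>1\<close>, \<open>i\<close>, \<open>j\<close>, \<open>k\<close>.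
\<close>

definition quaternion_matrix :: "nat \<Rightarrow> nat \<Rightarrow> nat \<Rightarrow> real" where
  "quaternion_matrix s i j =
    [[[1, 0, 0, 0], [0, 1, 0, 0], [0, 0, 1, 0], [0, 0, 0, 1]],
     [[0, -1, 0, 0], [1, 0, 0, 0], [0, 0, 0, -1], [0, 0, 1, 0]],
     [[0, 0, -1, 0], [0, 0, 0, 1], [1, 0, 0, 0], [0, -1, 0, 0]],
     [[0, 0, 0, -1], [0, 0, -1, 0], [0, 1, 0, 0], [1, 0, 0, 0]]] ! s ! i ! j"

text \<open>
  The character table of the Klein four-group, a Hadamard matrix of order four.
\<close>

definition hadamard_sign :: "nat \<Rightarrow> nat \<Rightarrow> real" where
  "hadamard_sign e s = [[1, 1, 1, 1], [1, -1, 1, -1], [1, 1, -1, -1], [1, -1, -1, 1]] ! e ! s"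

lemma less_4_cases: "s < (4 :: nat) \<Longrightarrow> s = 0 \<or> s = 1 \<or> s = 2 \<or> s = 3"
  by linarith

lemma lessThan_4: "{..<4 :: nat} = {0, 1, 2, 3}"
  by auto

lemma quaternion_clifford:
  assumes "s < 4" "t < 4" "i < 4" "j < 4"
  shows "(\<Sum>r<4. quaternion_matrix s r i * quaternion_matrix t r j)
       + (\<Sum>r<4. quaternion_matrix t r i * quaternion_matrix s r j)
       = (if s = t \<and> i = j then 2 else 0)"
  using assms[THEN less_4_cases]
  by (elim disjE) (simp_all add: quaternion_matrix_def lessThan_4)

lemma quaternion_rows_orthonormal:
  assumes "s < 4" "i < 4" "j < 4"
  shows "(\<Sum>r<4. quaternion_matrix s i r * quaternion_matrix s j r) = (if i = j then 1 else 0)"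
  using assms[THEN less_4_cases]
  by (elim disjE) (simp_all add: quaternion_matrix_def lessThan_4)

lemma hadamard_sign_orthogonal:
  assumes "s < 4" "t < 4"
  shows "(\<Sum>e<4. hadamard_sign e s * hadamard_sign e t) = (if s = t then 4 else 0)"
  using assms[THEN less_4_cases]
  by (elim disjE) (simp_all add: hadamard_sign_def lessThan_4)

lemma hadamard_sign_square:
  assumes "e < 4" "s < 4"
  shows "hadamard_sign e s * hadamard_sign e s = 1"
  using assms[THEN less_4_cases]
  by (elim disjE) (simp_all add: hadamard_sign_def)

text \<open>
  Exchanging \<open>s\<close> and \<open>t\<close> and using the symmetry of \<open>A\<close> replaces the product \<open>q\<^sub>s\<^sup>T q\<^sub>t\<close> by
  \<open>q\<^sub>t\<^sup>T q\<^sub>s\<close>.  Adding both forms of the sum brings in the Clifford relation, which leaves only the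
  terms with \<open>s = t\<close>, where the sign is squared.
\<close>

lemma clifford_sum_diagonal:
  fixes A :: "nat \<Rightarrow> nat \<Rightarrow> complex"
  assumes "\<beta> \<le> 4" "e < 4" "i < 4" "j < 4"
    and sym: "\<And>s t. s < \<beta> \<Longrightarrow> t < \<beta> \<Longrightarrow> A s t = A t s"
  shows "(\<Sum>s<\<beta>. \<Sum>t<\<beta>. of_real (hadamard_sign e s * hadamard_sign e t *
            (\<Sum>r<4. quaternion_matrix s r i * quaternion_matrix t r j)) * A s t)
       = (if i = j then \<Sum>s<\<beta>. A s s else 0)"
proof -
  define g where "g = (\<lambda>s t. hadamard_sign e s * hadamard_sign e t)"
  define K where "K = (\<lambda>s t. \<Sum>r<4. quaternion_matrix s r i * quaternion_matrix t r j)"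
  let ?L = "\<Sum>s<\<beta>. \<Sum>t<\<beta>. of_real (g s t * K s t) * A s t"
  have "?L = (\<Sum>s<\<beta>. \<Sum>t<\<beta>. of_real (g s t * K t s) * A s t)"
    by (subst sum.swap, intro sum.cong refl) (simp add: g_def sym mult_ac)
  then have "2 * ?L = (\<Sum>s<\<beta>. \<Sum>t<\<beta>. of_real (g s t * (K s t + K t s)) * A s t)"
    by (simp add: sum.distrib algebra_simps)
  also have "\<dots> = (\<Sum>s<\<beta>. \<Sum>t<\<beta>. if s = t then (if i = j then 2 * A s s else 0) else 0)"
  proof (intro sum.cong refl)
    fix s t assume "s \<in> {..<\<beta>}" "t \<in> {..<\<beta>}"
    with \<open>\<beta> \<le> 4\<close> have "s < 4" "t < 4"
      by auto
    then have "K s t + K t s = (if s = t \<and> i = j then 2 else 0)"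
      unfolding K_def using assms by (intro quaternion_clifford)
    moreover have "g s s = 1"
      using \<open>s < 4\<close> assms by (simp add: g_def hadamard_sign_square)
    ultimately show "of_real (g s t * (K s t + K t s)) * A s t
        = (if s = t then (if i = j then 2 * A s s else 0) else 0)"
      by (cases "s = t") auto
  qed
  also have "\<dots> = 2 * (if i = j then \<Sum>s<\<beta>. A s s else 0)"
    by (simp add: sum_distrib_left)
  finally show ?thesis
    by (simp add: g_def K_def)
qed

text \<open>
  The columns of the sign matrix are orthogonal of squared length four, so summing over the sign
  patterns separates the terms \<open>s\<close>; each matrix \<open>q\<^sub>s\<^sup>T\<close> is orthogonal and preserves the norm.
\<close>

lemma sum_norm_sq_signed_quaternion:
  fixes z :: "nat \<Rightarrow> nat \<Rightarrow> complex"
  assumes "\<beta> \<le> 4"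
  shows "(\<Sum>e<4. \<Sum>j<4. (cmod (\<Sum>s<\<beta>. of_real (hadamard_sign e s) *
            (\<Sum>r<4. of_real (quaternion_matrix s r j) * z s r)))\<^sup>2)
       = 4 * (\<Sum>s<\<beta>. \<Sum>r<4. (cmod (z s r))\<^sup>2)"
proof -
  define y where "y = (\<lambda>s j. \<Sum>r<4. of_real (quaternion_matrix s r j) * z s r)"
  have "(\<Sum>e<4. 1 * (cmod (\<Sum>s<\<beta>. of_real (hadamard_sign e s) * y s j))\<^sup>2)
      = (\<Sum>s<\<beta>. 4 * (cmod (y s j))\<^sup>2)" for j
  proof (rule sum_norm_sq_gram_diagonal)
    fix s t assume "s \<in> {..<\<beta>}" "t \<in> {..<\<beta>}"
    with assms have "s < 4" "t < 4"
      by auto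
    then show "(\<Sum>e<4. complex_of_real 1 *
        (cnj (of_real (hadamard_sign e s)) * of_real (hadamard_sign e t)))
        = (if s = t then of_real 4 else 0)"
      using arg_cong[OF hadamard_sign_orthogonal, of s t complex_of_real] by simp
  qed simp
  then have "(\<Sum>e<4. \<Sum>j<4. (cmod (\<Sum>s<\<beta>. of_real (hadamard_sign e s) * y s j))\<^sup>2)
      = 4 * (\<Sum>s<\<beta>. \<Sum>j<4. (cmod (y s j))\<^sup>2)"
    by (subst sum.swap, subst (2) sum.swap) (simp add: sum_distrib_left)
  moreover have "(\<Sum>j<4. 1 * (cmod (y s j))\<^sup>2) = (\<Sum>r<4. 1 * (cmod (z s r))\<^sup>2)" if "s < \<beta>" for s
    unfolding y_def
  proof (rule sum_norm_sq_gram_diagonal)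
    fix r r' :: nat assume "r \<in> {..<4}" "r' \<in> {..<4}"
    with that assms show "(\<Sum>j<4. complex_of_real 1 *
        (cnj (of_real (quaternion_matrix s r j)) * of_real (quaternion_matrix s r' j)))
        = (if r = r' then of_real 1 else 0)"
      using arg_cong[OF quaternion_rows_orthonormal, of s r r' complex_of_real] by simp
  qed simp
  ultimately show ?thesis
    by (simp add: y_def)
qed

section \<open>The dimension count\<close>

text \<open>
  Here \<open>c s\<close> is the \<open>N \<times> n\<close> matrix \<open>C\<^sub>s\<close>.  The hypotheses say, in this order, that
  \<open>C\<^sub>s\<^sup>* C\<^sub>t = C\<^sub>t\<^sup>* C\<^sub>s\<close>, that \<open>\<Delta> = \<Sum>\<^sub>s C\<^sub>s\<^sup>* C\<^sub>s\<close> is diagonalised by the unitary \<open>w\<close> with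
  eigenvalues \<open>d\<close>, and that the coordinates of \<open>\<complex>\<^sup>N\<close> are chosen such that
  \<open>C C\<^sup>* = \<Sum>\<^sub>s C\<^sub>s C\<^sub>s\<^sup>*\<close> is the diagonal matrix \<open>h\<close>.  The number \<open>\<mu>\<close> stands for
  \<open>\<lambda>\<^sub>1\<^sub>+\<^sub>k(\<Delta>)\<close>.  If the first \<open>m > 4k\<close> diagonal entries of \<open>C C\<^sup>*\<close> all exceeded \<open>\<mu>\<close>, then so would
  the quadratic form on all nonzero vectors supported there, whereas the dimension count produces
  one such vector where the form is at most \<open>\<mu>\<close>.
\<close>

lemma partial_trace_eigenvalue_bound:
  fixes c :: "nat \<Rightarrow> nat \<Rightarrow> nat \<Rightarrow> complex" and w :: "nat \<Rightarrow> nat \<Rightarrow> complex" and h d :: "nat \<Rightarrow> real"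
  assumes "\<beta> \<le> 4"
    and sym: "\<And>s t a b. s < \<beta> \<Longrightarrow> t < \<beta> \<Longrightarrow> a < n \<Longrightarrow> b < n \<Longrightarrow>
      (\<Sum>i<N. cnj (c s i a) * c t i b) = (\<Sum>i<N. cnj (c t i a) * c s i b)"
    and delta: "\<And>a b. a < n \<Longrightarrow> b < n \<Longrightarrow>
      (\<Sum>s<\<beta>. \<Sum>i<N. cnj (c s i a) * c s i b) = (\<Sum>j<n. of_real (d j) * (w a j * cnj (w b j)))"
    and w: "\<And>a b. a < n \<Longrightarrow> b < n \<Longrightarrow>
      (\<Sum>j<n. w a j * cnj (w b j)) = (if a = b then 1 else 0)"
    and cc: "\<And>i j. i < N \<Longrightarrow> j < N \<Longrightarrow>
      (\<Sum>s<\<beta>. \<Sum>a<n. c s i a * cnj (c s j a)) = (if i = j then of_real (h i) else 0)"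
    and d: "\<And>j. k \<le> j \<Longrightarrow> j < n \<Longrightarrow> d j \<le> \<mu>" and "0 \<le> \<mu>"
    and "m \<le> N" "4 * k < m"
  shows "\<exists>i<m. h i \<le> \<mu>"
proof (rule ccontr)
  assume "\<not> ?thesis"
  then have h: "\<mu> < h i" if "i < m" for i
    using that by force
  \<comment> \<open>\<open>Q e\<close> is the matrix of \<open>\<Sum>\<^sub>s \<epsilon>\<^sub>s C\<^sub>s \<otimes> q\<^sub>s\<close> for the \<open>e\<close>-th sign pattern\<close>
  define Q where "Q = (\<lambda>e (i, r) (b, j).
    \<Sum>s<\<beta>. of_real (hadamard_sign e s * quaternion_matrix s r j) * c s i b)"
  define D where "D = (\<lambda>a b. \<Sum>s<\<beta>. \<Sum>i<N. cnj (c s i a) * c s i b)"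
  let ?X = "{..<m} \<times> {..<4 :: nat}" and ?E = "{..<4 :: nat} \<times> {..<4 :: nat} \<times> {..<k}"
  let ?I = "{..<N} \<times> {..<4 :: nat}" and ?J = "{..<n} \<times> {..<4 :: nat}"
  \<comment> \<open>the equations \<open>\<langle>w\<^sub>j, Q\<^sub>e\<^sup>* x\<rangle> = 0\<close> in the coordinate \<open>r\<close>, for the top \<open>k\<close> eigenvectors \<open>w\<^sub>j\<close>
    of \<open>\<Delta>\<close>: \<open>16 k\<close> equations in \<open>4 m \<ge> 16 k + 4\<close> unknowns\<close>
  define M where "M = (\<lambda>(e, r, j) p. \<Sum>b<n. cnj (w b j) * cnj (Q e p (b, r)))"
  have "finite ?E" "finite ?X" "card ?E < card ?X"
    using \<open>4 * k < m\<close> by simp_all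
  then obtain x0 where x0: "\<exists>p\<in>?X. x0 p \<noteq> 0"
    and sol: "\<And>f. f \<in> ?E \<Longrightarrow> (\<Sum>p\<in>?X. M f p * x0 p) = 0"
    by (rule underdetermined_system_solution[of ?E ?X M]) blast
  define x where "x = (\<lambda>p. if p \<in> ?X then x0 p else 0)"
  define v where "v = (\<lambda>e q. \<Sum>p\<in>?I. cnj (Q e p q) * x p)"
  have "?X \<subseteq> ?I"
    using \<open>m \<le> N\<close> by auto
  have v_X: "v e q = (\<Sum>p\<in>?X. cnj (Q e p q) * x0 p)" for e q
    unfolding v_def using \<open>?X \<subseteq> ?I\<close>
    by (intro sum.mono_neutral_cong_right) (auto simp: x_def)
  have orth: "(\<Sum>b<n. cnj (w b j) * v e (b, r)) = 0" if "e < 4" "r < 4" "j < k" for e r j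
  proof -
    have "(\<Sum>b<n. cnj (w b j) * v e (b, r))
        = (\<Sum>p\<in>?X. \<Sum>b<n. cnj (w b j) * (cnj (Q e p (b, r)) * x0 p))"
      by (simp only: v_X sum_distrib_left) (rule sum.swap)
    also have "\<dots> = 0"
      using sol[of "(e, r, j)"] that by (simp add: M_def sum_distrib_left sum_distrib_right mult_ac)
    finally show ?thesis .
  qed
  \<comment> \<open>\<open>Q\<^sub>e\<^sup>* Q\<^sub>e = \<Delta> \<otimes> I\<close>\<close>
  have gram: "(\<Sum>p\<in>?I. of_real 1 * (cnj (Q e p q) * Q e p q'))
      = (if snd q = snd q' then D (fst q) (fst q') else 0)"
    if "e < 4" "q \<in> ?J" "q' \<in> ?J" for e q q'
  proof -
    obtain a i b j where q: "q = (a, i)" "q' = (b, j)"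
      by (cases q, cases q')
    with that have "a < n" "b < n" "i < 4" "j < 4"
      by auto
    let ?\<epsilon> = "hadamard_sign e" and ?q = quaternion_matrix
    have "(\<Sum>p\<in>?I. of_real 1 * (cnj (Q e p q) * Q e p q'))
        = (\<Sum>l<N. \<Sum>r<4. \<Sum>s<\<beta>. \<Sum>t<\<beta>.
            of_real (?\<epsilon> s * ?\<epsilon> t * (?q s r i * ?q t r j)) * (cnj (c s l a) * c t l b))"
      by (simp add: Q_def q sum.cartesian_product' sum_product) (simp add: mult_ac)
    also have "\<dots> = (\<Sum>s<\<beta>. \<Sum>t<\<beta>. \<Sum>r<4. \<Sum>l<N.
            of_real (?\<epsilon> s * ?\<epsilon> t * (?q s r i * ?q t r j)) * (cnj (c s l a) * c t l b))"
      by (simp only: sum.swap[of _ "{..<\<beta>}" "{..<4}"] sum.swap[of _ "{..<\<beta>}" "{..<N}"]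
            sum.swap[of _ "{..<4}" "{..<N}"])
    also have "\<dots> = (\<Sum>s<\<beta>. \<Sum>t<\<beta>. of_real (?\<epsilon> s * ?\<epsilon> t * (\<Sum>r<4. ?q s r i * ?q t r j))
            * (\<Sum>l<N. cnj (c s l a) * c t l b))"
      by (simp add: sum_distrib_left sum_distrib_right mult_ac)
    also have "\<dots> = (if i = j then \<Sum>s<\<beta>. \<Sum>l<N. cnj (c s l a) * c s l b else 0)"
      using \<open>\<beta> \<le> 4\<close> \<open>e < 4\<close> \<open>i < 4\<close> \<open>j < 4\<close> sym[OF _ _ \<open>a < n\<close> \<open>b < n\<close>]
      by (rule clifford_sum_diagonal)
    finally show ?thesis
      by (simp add: q D_def)
  qed
  \<comment> \<open>\<open>\<parallel>Q\<^sub>e\<^sup>* x\<parallel>\<^sup>2 \<le> \<mu> \<parallel>x\<parallel>\<^sup>2\<close>, because \<open>Q\<^sub>e\<^sup>* x\<close> avoids the eigenvectors of \<open>\<Delta>\<close> above \<open>\<mu>\<close>\<close>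
  have bound: "(\<Sum>q\<in>?J. (cmod (v e q))\<^sup>2) \<le> \<mu> * (\<Sum>p\<in>?I. (cmod (x p))\<^sup>2)" if "e < 4" for e
  proof (rule adjoint_norm_le_of_norm_le)
    define f where "f = (\<lambda>r j. (cmod (\<Sum>b<n. cnj (w b j) * v e (b, r)))\<^sup>2)"
    have "complex_of_real (\<Sum>p\<in>?I. 1 * (cmod (\<Sum>q\<in>?J. Q e p q * v e q))\<^sup>2)
        = (\<Sum>q\<in>?J. \<Sum>q'\<in>?J. cnj (v e q) * v e q' *
            (if snd q = snd q' then D (fst q) (fst q') else 0))"
      using gram[OF that] by (rule sum_norm_sq_gram)
    also have "\<dots> = (\<Sum>a<n. \<Sum>r<4. \<Sum>b<n. cnj (v e (a, r)) * v e (b, r) * D a b)"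
      by (simp add: sum.cartesian_product' if_distrib[of "\<lambda>x. _ * x"] cong: if_cong)
    also have "\<dots> = (\<Sum>r<4. \<Sum>a<n. \<Sum>b<n. cnj (v e (a, r)) * v e (b, r) * D a b)"
      by (rule sum.swap)
    also have "\<dots> = (\<Sum>r<4. complex_of_real (\<Sum>j<n. d j * f r j))"
      unfolding f_def
      by (intro sum.cong refl sum_norm_sq_gram[symmetric]) (simp add: D_def delta)
    finally have "complex_of_real (\<Sum>p\<in>?I. (cmod (\<Sum>q\<in>?J. Q e p q * v e q))\<^sup>2)
        = complex_of_real (\<Sum>r<4. \<Sum>j<n. d j * f r j)"
      by simp
    then have "(\<Sum>p\<in>?I. (cmod (\<Sum>q\<in>?J. Q e p q * v e q))\<^sup>2) = (\<Sum>r<4. \<Sum>j<n. d j * f r j)"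
      by (simp only: of_real_eq_iff)
    also have "\<dots> \<le> (\<Sum>r<4. \<Sum>j<n. \<mu> * f r j)"
    proof (intro sum_mono)
      fix r j :: nat assume "r \<in> {..<4}" "j \<in> {..<n}"
      show "d j * f r j \<le> \<mu> * f r j"
      proof (cases "j < k")
        case True
        with orth[OF that] \<open>r \<in> {..<4}\<close> have "f r j = 0"
          by (simp add: f_def)
        then show ?thesis
          by simp
      next
        case False
        with d \<open>j \<in> {..<n}\<close> show ?thesis
          by (intro mult_right_mono) (auto simp: f_def)
      qed
    qed
    also have "\<dots> = \<mu> * (\<Sum>r<4. \<Sum>j<n. 1 * f r j)"
      by (simp add: sum_distrib_left)
    also have "\<dots> = \<mu> * (\<Sum>r<4. \<Sum>b<n. 1 * (cmod (v e (b, r)))\<^sup>2)"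
      unfolding f_def
      by (intro arg_cong[of _ _ "\<lambda>x. \<mu> * x"] sum.cong refl sum_norm_sq_gram_diagonal) (simp_all add: w)
    also have "\<dots> = \<mu> * (\<Sum>q\<in>?J. (cmod (v e q))\<^sup>2)"
      by (subst sum.swap) (simp add: sum.cartesian_product')
    finally show "(\<Sum>p\<in>?I. (cmod (\<Sum>q\<in>?J. Q e p q * v e q))\<^sup>2) \<le> \<mu> * (\<Sum>q\<in>?J. (cmod (v e q))\<^sup>2)" .
  qed (use \<open>0 \<le> \<mu>\<close> in \<open>simp_all add: v_def\<close>)
  \<comment> \<open>\<open>z b s\<close> collects the four coordinates of \<open>(C\<^sub>s\<^sup>* x)\<^sub>b\<close>; summing over the sign patterns
    yields \<open>\<Sum>\<^sub>e \<parallel>Q\<^sub>e\<^sup>* x\<parallel>\<^sup>2 = 4 \<langle>x, (C C\<^sup>* \<otimes> I) x\<rangle>\<close>\<close>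
  define z where "z = (\<lambda>b s r. \<Sum>i<N. cnj (c s i b) * x (i, r))"
  have v_z: "v e (b, j) = (\<Sum>s<\<beta>. of_real (hadamard_sign e s) *
      (\<Sum>r<4. of_real (quaternion_matrix s r j) * z b s r))" for e b j
  proof -
    have "v e (b, j) = (\<Sum>i<N. \<Sum>r<4. \<Sum>s<\<beta>.
        of_real (hadamard_sign e s) * (of_real (quaternion_matrix s r j) * (cnj (c s i b) * x (i, r))))"
      by (simp add: v_def Q_def sum.cartesian_product' sum_distrib_left sum_distrib_right mult_ac)
    also have "\<dots> = (\<Sum>s<\<beta>. \<Sum>r<4. \<Sum>i<N.
        of_real (hadamard_sign e s) * (of_real (quaternion_matrix s r j) * (cnj (c s i b) * x (i, r))))"
      by (simp only: sum.swap[of _ "{..<\<beta>}" "{..<4}"] sum.swap[of _ "{..<\<beta>}" "{..<N}"]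
            sum.swap[of _ "{..<4}" "{..<N}"])
    finally show ?thesis
      by (simp add: z_def sum_distrib_left)
  qed
  have "(\<Sum>e<4. \<Sum>q\<in>?J. (cmod (v e q))\<^sup>2) = (\<Sum>b<n. \<Sum>e<4. \<Sum>j<4. (cmod (v e (b, j)))\<^sup>2)"
    by (subst (2) sum.swap) (simp add: sum.cartesian_product')
  also have "\<dots> = (\<Sum>b<n. 4 * (\<Sum>s<\<beta>. \<Sum>r<4. (cmod (z b s r))\<^sup>2))"
    unfolding v_z by (simp only: sum_norm_sq_signed_quaternion[OF \<open>\<beta> \<le> 4\<close>])
  also have "\<dots> = 4 * (\<Sum>r<4. \<Sum>s<\<beta>. \<Sum>b<n. (cmod (z b s r))\<^sup>2)"
    by (simp only: sum.swap[of _ "{..<\<beta>}" "{..<n}"] sum.swap[of _ "{..<4}" "{..<n}"]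
          sum.swap[of _ "{..<4}" "{..<\<beta>}"] sum_distrib_left)
  also have "\<dots> = 4 * (\<Sum>r<4. \<Sum>i<N. h i * (cmod (x (i, r)))\<^sup>2)"
  proof -
    have "(\<Sum>p\<in>{..<\<beta>} \<times> {..<n}. 1 * (cmod (\<Sum>i<N. cnj (c (fst p) i (snd p)) * x (i, r)))\<^sup>2)
        = (\<Sum>i<N. h i * (cmod (x (i, r)))\<^sup>2)" for r
    proof (rule sum_norm_sq_gram_diagonal)
      fix i j assume "i \<in> {..<N}" "j \<in> {..<N}"
      then show "(\<Sum>p\<in>{..<\<beta>} \<times> {..<n}. complex_of_real 1 *
          (cnj (cnj (c (fst p) i (snd p))) * cnj (c (fst p) j (snd p))))
          = (if i = j then of_real (h i) else 0)"
        using cc[of i j] by (simp add: sum.cartesian_product')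
    qed simp
    then show ?thesis
      by (simp add: z_def sum.cartesian_product split_def)
  qed
  also have "\<dots> = 4 * (\<Sum>p\<in>?I. h (fst p) * (cmod (x p))\<^sup>2)"
    by (subst sum.swap) (simp add: sum.cartesian_product')
  finally have total: "(\<Sum>e<4. \<Sum>q\<in>?J. (cmod (v e q))\<^sup>2)
      = 4 * (\<Sum>p\<in>?I. h (fst p) * (cmod (x p))\<^sup>2)" .
  have "(\<Sum>e<4. \<Sum>q\<in>?J. (cmod (v e q))\<^sup>2) \<le> (\<Sum>e<4 :: nat. \<mu> * (\<Sum>p\<in>?I. (cmod (x p))\<^sup>2))"
    by (intro sum_mono bound) simp
  then have "(\<Sum>e<4. \<Sum>q\<in>?J. (cmod (v e q))\<^sup>2) \<le> 4 * (\<mu> * (\<Sum>p\<in>?I. (cmod (x p))\<^sup>2))"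
    by simp
  with total have "(\<Sum>p\<in>?I. h (fst p) * (cmod (x p))\<^sup>2) \<le> (\<Sum>p\<in>?I. \<mu> * (cmod (x p))\<^sup>2)"
    by (simp flip: sum_distrib_left)
  moreover have "(\<Sum>p\<in>?I. \<mu> * (cmod (x p))\<^sup>2) < (\<Sum>p\<in>?I. h (fst p) * (cmod (x p))\<^sup>2)"
  proof (rule sum_strict_mono_ex1)
    show "\<forall>p\<in>?I. \<mu> * (cmod (x p))\<^sup>2 \<le> h (fst p) * (cmod (x p))\<^sup>2"
      by (auto simp: x_def intro!: mult_right_mono less_imp_le[OF h])
    obtain p where "p \<in> ?X" "x0 p \<noteq> 0"
      using x0 by blast
    then show "\<exists>p\<in>?I. \<mu> * (cmod (x p))\<^sup>2 < h (fst p) * (cmod (x p))\<^sup>2"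
      using \<open>?X \<subseteq> ?I\<close> by (intro bexI[of _ p]) (auto simp: x_def intro!: mult_strict_right_mono h)
  qed simp
  ultimately show False
    by linarith
qed

section \<open>The spectral theorem for Hermitian matrices\<close>

lemma mat_adjoint_index:
  fixes A :: "'a::conjugatable_field mat"
  assumes "A \<in> carrier_mat n n" "i < n" "j < n"
  shows "mat_adjoint A $$ (i, j) = conjugate (A $$ (j, i))"
  using assms by (auto simp: mat_adjoint_def mat_of_rows_def)

lemma hermitian_mat_index:
  fixes A :: "'a::conjugatable_field mat"
  assumes "hermitian_mat A" "A \<in> carrier_mat n n" "i < n" "j < n"
  shows "A $$ (i, j) = conjugate (A $$ (j, i))"
  using mat_adjoint_index[OF assms(2-)] assms(1) by (simp add: hermitian_mat_def)

lemma hermitian_matI: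
  fixes A :: "'a::conjugatable_field mat"
  assumes A: "A \<in> carrier_mat n n"
    and entries: "\<And>i j. i < n \<Longrightarrow> j < n \<Longrightarrow> A $$ (i, j) = conjugate (A $$ (j, i))"
  shows "hermitian_mat A"
  unfolding hermitian_mat_def
proof (rule eq_matI)
  fix i j assume "i < dim_row A" "j < dim_col A"
  then have "i < n" "j < n"
    using A by auto
  then show "mat_adjoint A $$ (i, j) = A $$ (i, j)"
    by (metis mat_adjoint_index[OF A] entries)
qed (use A in \<open>auto simp: mat_adjoint_def\<close>)

text \<open>
  An eigenvector \<open>v\<close> for \<open>e\<close> gives \<open>v\<^sup>* A v = e \<parallel>v\<parallel>\<^sup>2\<close>, and the left-hand side is its own conjugate.
\<close>

lemma hermitian_char_poly_real_roots:
  fixes A :: "complex mat"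
  assumes A: "A \<in> carrier_mat n n" and "hermitian_mat A"
  obtains es :: "real list" where "length es = n" "sorted_wrt (\<ge>) es"
    "char_poly A = (\<Prod>e\<leftarrow>es. [:- of_real e, 1:])"
proof -
  obtain as where as: "char_poly A = (\<Prod>a\<leftarrow>as. [:- a, 1:])" "length as = n"
    using char_poly_factorized[OF A] by blast
  have real: "of_real (Re e) = e" if "e \<in> set as" for e
  proof -
    have "poly (char_poly A) e = 0"
      using that by (simp add: as(1) poly_prod_list prod_list_zero_iff image_iff)
    then have "eigenvalue A e"
      using eigenvalue_root_char_poly[OF A] by simp
    then obtain v where v: "v \<in> carrier_vec n" "v \<noteq> 0\<^sub>v n" "A *\<^sub>v v = e \<cdot>\<^sub>v v"
      using A by (auto simp: eigenvalue_def eigenvector_def)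
    let ?S = "\<Sum>x<n. (cmod (v $ x))\<^sup>2"
    have ev: "(\<Sum>y<n. A $$ (x, y) * v $ y) = e * v $ x" if "x < n" for x
      using arg_cong[OF v(3), of "\<lambda>w. w $ x"] that A v(1)
      by (simp add: scalar_prod_def lessThan_atLeast0)
    have form: "(\<Sum>x<n. \<Sum>y<n. cnj (v $ x) * (A $$ (x, y) * v $ y)) = e * of_real ?S"
    proof -
      have "(\<Sum>x<n. \<Sum>y<n. cnj (v $ x) * (A $$ (x, y) * v $ y)) = (\<Sum>x<n. cnj (v $ x) * (e * v $ x))"
        by (simp add: ev flip: sum_distrib_left)
      also have "\<dots> = e * of_real ?S"
        by (simp only: of_real_sum complex_norm_square sum_distrib_left mult_ac)
      finally show ?thesis .
    qed
    have "cnj (\<Sum>x<n. \<Sum>y<n. cnj (v $ x) * (A $$ (x, y) * v $ y))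
        = (\<Sum>x<n. \<Sum>y<n. v $ x * (cnj (A $$ (x, y)) * cnj (v $ y)))"
      by simp
    also have "\<dots> = (\<Sum>y<n. \<Sum>x<n. v $ x * (cnj (A $$ (x, y)) * cnj (v $ y)))"
      by (rule sum.swap)
    also have "\<dots> = (\<Sum>x<n. \<Sum>y<n. cnj (v $ x) * (A $$ (x, y) * v $ y))"
    proof (intro sum.cong refl)
      fix x y assume "x \<in> {..<n}" "y \<in> {..<n}"
      then have "A $$ (x, y) = cnj (A $$ (y, x))"
        using hermitian_mat_index[OF assms(2) A, of x y] by (simp only: conjugate_complex_def lessThan_iff)
      then show "v $ y * (cnj (A $$ (y, x)) * cnj (v $ x)) = cnj (v $ x) * (A $$ (x, y) * v $ y)"
        by (simp only: mult_ac)
    qed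
    finally have "cnj e * of_real ?S = e * of_real ?S"
      unfolding form by simp
    moreover have "?S \<noteq> 0"
    proof
      assume "?S = 0"
      then have "\<forall>x<n. v $ x = 0"
        by (simp add: sum_nonneg_eq_0_iff)
      with v show False
        by auto
    qed
    ultimately have "cnj e = e"
      by (metis mult_cancel_right of_real_eq_0_iff)
    then show ?thesis
      by (simp add: complex_eq_iff)
  qed
  define es where "es = rev (sort (map Re as))"
  have "mset (map complex_of_real es) = mset as"
  proof -
    have "mset (map complex_of_real es) = image_mset (\<lambda>e. of_real (Re e)) (mset as)"
      by (simp add: es_def multiset.map_comp o_def)
    also have "\<dots> = image_mset (\<lambda>e. e) (mset as)"
      using real by (intro image_mset_cong) simp
    also have "\<dots> = mset as"
      by simp
    finally show ?thesis .
  qed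
  moreover have "(\<Prod>a\<leftarrow>xs. [:- a, 1:]) = prod_mset (image_mset (\<lambda>a. [:- a, 1:]) (mset xs))"
    for xs :: "complex list"
    by (simp add: prod_mset_prod_list flip: mset_map)
  ultimately have "(\<Prod>a\<leftarrow>map complex_of_real es. [:- a, 1:]) = (\<Prod>a\<leftarrow>as. [:- a, 1:])"
    by (simp only:)
  then have "char_poly A = (\<Prod>e\<leftarrow>es. [:- of_real e, 1:])"
    by (simp add: as o_def)
  moreover have "length es = n" "sorted_wrt (\<ge>) es"
    using as by (simp_all add: es_def sorted_wrt_rev)
  ultimately show thesis
    using that by blast
qed

text \<open>
  The columns of \<open>p\<close> span a flag of subspaces \<open>V\<^sub>0 \<subseteq> V\<^sub>1 \<subseteq> \<dots>\<close> that \<open>a\<close> preserves, acting on it by the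
  upper triangular matrix \<open>t\<close>.  A unit vector \<open>v\<close> in \<open>V\<^sub>i\<^sub>+\<^sub>1\<close> orthogonal to \<open>V\<^sub>i\<close> is found by solving
  \<open>i\<close> equations in \<open>i + 1\<close> unknowns.  The vector \<open>r = a v - t\<^sub>i\<^sub>i v\<close> lies in \<open>V\<^sub>i\<close>, since its
  coefficient at the \<open>i\<close>-th column of \<open>p\<close> cancels, and it is orthogonal to \<open>V\<^sub>i\<close>, since \<open>a\<close> is Hermitian and preserves
  \<open>V\<^sub>i\<close>.  So \<open>r = 0\<close>.
\<close>

lemma eigenvector_from_triangular_flag:
  fixes a p t :: "nat \<Rightarrow> nat \<Rightarrow> complex"
  assumes herm: "\<And>x y. x < n \<Longrightarrow> y < n \<Longrightarrow> a x y = cnj (a y x)"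
    and flag: "\<And>x j. x < n \<Longrightarrow> j < n \<Longrightarrow> (\<Sum>y<n. a x y * p y j) = (\<Sum>l<n. t l j * p x l)"
    and upper: "\<And>l j. j < l \<Longrightarrow> l < n \<Longrightarrow> t l j = 0"
    and indep: "\<And>c l. (\<And>x. x < n \<Longrightarrow> (\<Sum>l<n. c l * p x l) = 0) \<Longrightarrow> l < n \<Longrightarrow> c l = 0"
    and "i < n"
  obtains c v where "\<And>x. x < n \<Longrightarrow> v x = (\<Sum>l\<le>i. c l * p x l)"
    "\<And>m. m < i \<Longrightarrow> (\<Sum>x<n. cnj (p x m) * v x) = 0"
    "(\<Sum>x<n. cnj (v x) * v x) = 1"
    "\<And>x. x < n \<Longrightarrow> (\<Sum>y<n. a x y * v y) = t i i * v x"
proof -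
  obtain c where c: "\<exists>l\<in>{..i}. c l \<noteq> 0"
    and sol: "\<And>m. m \<in> {..<i} \<Longrightarrow> (\<Sum>l\<in>{..i}. (\<Sum>x<n. cnj (p x m) * p x l) * c l) = 0"
    by (rule underdetermined_system_solution[of "{..<i}" "{..i}" "\<lambda>m l. \<Sum>x<n. cnj (p x m) * p x l"]) auto
  define v where "v = (\<lambda>x. \<Sum>l\<le>i. c l * p x l)"
  define c' where "c' = (\<lambda>l. if l \<le> i then c l else 0)"
  have v': "v x = (\<Sum>l<n. c' l * p x l)" for x
    unfolding v_def c'_def using \<open>i < n\<close> by (intro sum.mono_neutral_cong_left) auto
  have orth: "(\<Sum>x<n. cnj (p x m) * v x) = 0" if "m < i" for m
  proof -
    have "(\<Sum>x<n. cnj (p x m) * v x) = (\<Sum>l\<le>i. \<Sum>x<n. cnj (p x m) * (c l * p x l))"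
      unfolding v_def sum_distrib_left by (rule sum.swap)
    also have "\<dots> = 0"
      using sol[of m] that by (simp add: sum_distrib_left sum_distrib_right mult_ac)
    finally show ?thesis .
  qed
  define S where "S = (\<Sum>x<n. (cmod (v x))\<^sup>2)"
  have "S \<noteq> 0"
  proof
    assume "S = 0"
    then have "\<forall>x<n. v x = 0"
      by (simp add: S_def sum_nonneg_eq_0_iff)
    then have c'0: "c' l = 0" if "l < n" for l
      using that by (intro indep[of c']) (simp_all add: v')
    obtain l where "l \<le> i" "c l \<noteq> 0"
      using c by blast
    with c'0[of l] \<open>i < n\<close> show False
      by (simp add: c'_def)
  qed
  moreover have "0 \<le> S"
    by (simp add: S_def sum_nonneg)
  ultimately have "0 < S"
    by simp
  define r where "r = (\<lambda>x. (\<Sum>y<n. a x y * v y) - t i i * v x)"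
  define e where "e = (\<lambda>m. (\<Sum>l\<le>i. t m l * c l) - t i i * c' m)"
  have r_flag: "r x = (\<Sum>m<n. e m * p x m)" if "x < n" for x
  proof -
    have "(\<Sum>y<n. a x y * v y) = (\<Sum>l\<le>i. c l * (\<Sum>y<n. a x y * p y l))"
      unfolding v_def sum_distrib_left by (subst sum.swap) (simp add: mult_ac)
    also have "\<dots> = (\<Sum>l\<le>i. c l * (\<Sum>m<n. t m l * p x m))"
      using flag[OF that] \<open>i < n\<close> by simp
    also have "\<dots> = (\<Sum>m<n. (\<Sum>l\<le>i. t m l * c l) * p x m)"
      unfolding sum_distrib_left sum_distrib_right by (subst sum.swap) (simp add: mult_ac)
    finally have "r x = (\<Sum>m<n. (\<Sum>l\<le>i. t m l * c l) * p x m) - t i i * v x"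
      by (simp add: r_def)
    also have "\<dots> = (\<Sum>m<n. e m * p x m)"
      by (simp add: e_def v' left_diff_distrib sum_subtractf sum_distrib_left mult.assoc)
    finally show ?thesis .
  qed
  have e0: "e m = 0" if "i \<le> m" "m < n" for m
  proof (cases "m = i")
    case True
    have "(\<Sum>l\<le>i. t i l * c l) = (\<Sum>l\<in>{i}. t i l * c l)"
      using \<open>i < n\<close> by (intro sum.mono_neutral_right) (auto simp: upper)
    with True show ?thesis
      by (simp add: e_def c'_def)
  next
    case False
    with that show ?thesis
      by (simp add: e_def c'_def upper)
  qed
  have pr0: "(\<Sum>x<n. cnj (p x m) * r x) = 0" if "m < i" for m
  proof -
    have "(\<Sum>x<n. cnj (p x m) * (\<Sum>y<n. a x y * v y))
        = (\<Sum>y<n. \<Sum>x<n. cnj (p x m) * (a x y * v y))"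
      unfolding sum_distrib_left by (rule sum.swap)
    also have "\<dots> = (\<Sum>y<n. cnj (\<Sum>x<n. a y x * p x m) * v y)"
    proof (intro sum.cong refl)
      fix y assume "y \<in> {..<n}"
      then have "cnj (p x m) * (a x y * v y) = cnj (a y x * p x m) * v y" if "x < n" for x
        using herm[of x y] that by (simp only: complex_cnj_mult lessThan_iff mult_ac)
      then show "(\<Sum>x<n. cnj (p x m) * (a x y * v y)) = cnj (\<Sum>x<n. a y x * p x m) * v y"
        unfolding cnj_sum sum_distrib_right by (intro sum.cong refl) (simp only: lessThan_iff)
    qed
    also have "\<dots> = (\<Sum>y<n. \<Sum>l<n. cnj (t l m) * (cnj (p y l) * v y))"
      using flag that \<open>i < n\<close> by (simp add: sum_distrib_left sum_distrib_right mult_ac)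
    also have "\<dots> = (\<Sum>l<n. cnj (t l m) * (\<Sum>y<n. cnj (p y l) * v y))"
      unfolding sum_distrib_left by (rule sum.swap)
    also have "\<dots> = 0"
    proof (intro sum.neutral ballI)
      fix l assume "l \<in> {..<n}"
      with that orth[of l] upper[of m l]
      show "cnj (t l m) * (\<Sum>y<n. cnj (p y l) * v y) = 0"
        by (cases "l \<le> m") auto
    qed
    finally have "(\<Sum>x<n. cnj (p x m) * (\<Sum>y<n. a x y * v y)) = 0" .
    moreover have "(\<Sum>x<n. cnj (p x m) * (t i i * v x)) = t i i * (\<Sum>x<n. cnj (p x m) * v x)"
      by (simp add: sum_distrib_left mult_ac)
    ultimately show ?thesis
      using orth[OF that] by (simp add: r_def right_diff_distrib sum_subtractf)
  qed
  have "complex_of_real (\<Sum>x<n. (cmod (r x))\<^sup>2) = (\<Sum>x<n. cnj (r x) * r x)"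
    by (simp only: of_real_sum complex_norm_square mult.commute)
  also have "\<dots> = (\<Sum>x<n. \<Sum>m<n. cnj (e m) * (cnj (p x m) * r x))"
    by (intro sum.cong refl) (simp add: r_flag[THEN arg_cong[of _ _ cnj]] sum_distrib_left mult_ac)
  also have "\<dots> = (\<Sum>m<n. cnj (e m) * (\<Sum>x<n. cnj (p x m) * r x))"
    unfolding sum_distrib_left by (rule sum.swap)
  also have "\<dots> = 0"
  proof (intro sum.neutral ballI)
    fix m assume "m \<in> {..<n}"
    then show "cnj (e m) * (\<Sum>x<n. cnj (p x m) * r x) = 0"
      by (cases "m < i") (simp_all add: pr0 e0)
  qed
  finally have "(\<Sum>x<n. (cmod (r x))\<^sup>2) = 0"
    by (simp only: of_real_eq_0_iff)
  then have r0: "r x = 0" if "x < n" for x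
    using that by (simp add: sum_nonneg_eq_0_iff)
  define k where "k = complex_of_real (1 / sqrt S)"
  have kk: "cnj k * k = of_real (1 / S)"
    using \<open>0 < S\<close> by (simp add: k_def flip: of_real_mult)
  show thesis
  proof (rule that[of "\<lambda>x. k * v x" "\<lambda>l. k * c l"])
    fix x assume "x < n"
    show "k * v x = (\<Sum>l\<le>i. k * c l * p x l)"
      by (simp add: v_def sum_distrib_left mult_ac)
    show "(\<Sum>y<n. a x y * (k * v y)) = t i i * (k * v x)"
    proof -
      have "(\<Sum>y<n. a x y * (k * v y)) = k * (\<Sum>y<n. a x y * v y)"
        by (simp add: sum_distrib_left mult_ac)
      with r0[OF \<open>x < n\<close>] show ?thesis
        by (simp add: r_def)
    qed
  next
    fix m assume "m < i"
    have "(\<Sum>x<n. cnj (p x m) * (k * v x)) = k * (\<Sum>x<n. cnj (p x m) * v x)"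
      by (simp add: sum_distrib_left mult_ac)
    with orth[OF \<open>m < i\<close>] show "(\<Sum>x<n. cnj (p x m) * (k * v x)) = 0"
      by simp
  next
    have "(\<Sum>x<n. cnj (k * v x) * (k * v x)) = cnj k * k * of_real S"
      unfolding S_def by (simp only: of_real_sum complex_norm_square sum_distrib_left complex_cnj_mult mult_ac)
    with kk \<open>S \<noteq> 0\<close> show "(\<Sum>x<n. cnj (k * v x) * (k * v x)) = 1"
      by (simp flip: of_real_mult)
  qed
qed

text \<open>
  The eigenvector to \<open>e i\<close> is \<open>\<lambda>x. u x i\<close>.  Orthonormality is recorded for both the columns and the
  rows of \<open>u\<close>, which avoids repeating the passage from \<open>u\<^sup>* u = I\<close> to \<open>u u\<^sup>* = I\<close>.
\<close>

definition orthonormal_eigenbasis ::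
    "nat \<Rightarrow> complex mat \<Rightarrow> (nat \<Rightarrow> real) \<Rightarrow> (nat \<Rightarrow> nat \<Rightarrow> complex) \<Rightarrow> bool" where
  "orthonormal_eigenbasis n A e u \<longleftrightarrow>
    (\<forall>i<n. \<forall>j<n. (\<Sum>x<n. cnj (u x i) * u x j) = (if i = j then 1 else 0)) \<and>
    (\<forall>x<n. \<forall>y<n. (\<Sum>i<n. u x i * cnj (u y i)) = (if x = y then 1 else 0)) \<and>
    (\<forall>i<n. \<forall>x<n. (\<Sum>y<n. A $$ (x, y) * u y i) = of_real (e i) * u x i)"

lemma orthonormal_eigenbasis_entry:
  assumes "orthonormal_eigenbasis n A e u" "x < n" "y < n"
  shows "A $$ (x, y) = (\<Sum>i<n. of_real (e i) * (u x i * cnj (u y i)))"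
proof -
  have rows: "(\<Sum>i<n. u x i * cnj (u y i)) = (if x = y then 1 else 0)" if "x < n" "y < n" for x y
    using assms(1) that unfolding orthonormal_eigenbasis_def by blast
  have ev: "(\<Sum>y<n. A $$ (x, y) * u y i) = of_real (e i) * u x i" if "i < n" for i
    using assms that unfolding orthonormal_eigenbasis_def by blast
  have "A $$ (x, y) = (\<Sum>z<n. A $$ (x, z) * (if z = y then 1 else 0))"
    using assms by (simp add: if_distrib[of "\<lambda>x. _ * x"] cong: if_cong)
  also have "\<dots> = (\<Sum>z<n. A $$ (x, z) * (\<Sum>i<n. u z i * cnj (u y i)))"
    using assms by (simp add: rows)
  also have "\<dots> = (\<Sum>i<n. (\<Sum>z<n. A $$ (x, z) * u z i) * cnj (u y i))"
    unfolding sum_distrib_left sum_distrib_right by (subst sum.swap) (simp add: mult_ac)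
  also have "\<dots> = (\<Sum>i<n. of_real (e i) * (u x i * cnj (u y i)))"
    by (simp add: ev mult.assoc)
  finally show ?thesis .
qed

text \<open>
  Schur's theorem gives \<open>A = P B P\<inverse>\<close> with \<open>B\<close> upper triangular and the roots of the characteristic
  polynomial on its diagonal in any prescribed order, here the decreasing one.  The columns of \<open>P\<close>
  form a flag as in \<open>eigenvector_from_triangular_flag\<close>.  Eigenvectors taken from different steps of the flag are
  orthogonal because each one is orthogonal to all smaller subspaces.
\<close>

lemma hermitian_spectral_decomposition:
  fixes A :: "complex mat"
  assumes A: "A \<in> carrier_mat n n" and "hermitian_mat A"
  obtains es :: "real list" and u :: "nat \<Rightarrow> nat \<Rightarrow> complex"
  where "length es = n" "sorted_wrt (\<ge>) es" "char_poly A = (\<Prod>e\<leftarrow>es. [:- of_real e, 1:])"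
    "orthonormal_eigenbasis n A (\<lambda>i. es ! i) u"
proof -
  obtain es :: "real list" where es: "length es = n" "sorted_wrt (\<ge>) es"
      "char_poly A = (\<Prod>e\<leftarrow>es. [:- of_real e, 1:])"
    using hermitian_char_poly_real_roots[OF assms] by blast
  obtain B P Q where "schur_decomposition A (map of_real es) = (B, P, Q)"
    by (cases "schur_decomposition A (map of_real es)")
  moreover have "char_poly A = (\<Prod>e\<leftarrow>map of_real es. [:- e, 1:])"
    by (simp add: es(3) o_def)
  ultimately have schur: "similar_mat_wit A B P Q" "upper_triangular B" "diag_mat B = map of_real es"
    using schur_decomposition[OF A] by blast+
  then have carrier: "B \<in> carrier_mat n n" "P \<in> carrier_mat n n" "Q \<in> carrier_mat n n"
    and QP: "Q * P = 1\<^sub>m n" and A_eq: "A = P * B * Q"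
    using A by (auto simp: similar_mat_wit_def Let_def)
  have "P * B * Q * P = P * B * (Q * P)"
    by (rule assoc_mult_mat[of _ n n _ n _ n]) (use carrier in auto)
  then have "A * P = P * B"
    using carrier by (simp add: A_eq QP)
  have flag: "(\<Sum>y<n. A $$ (x, y) * P $$ (y, j)) = (\<Sum>l<n. B $$ (l, j) * P $$ (x, l))"
    if "x < n" "j < n" for x j
  proof -
    have "(\<Sum>y<n. A $$ (x, y) * P $$ (y, j)) = (A * P) $$ (x, j)"
      using that A carrier by (simp add: scalar_prod_def lessThan_atLeast0)
    also have "\<dots> = (\<Sum>l<n. B $$ (l, j) * P $$ (x, l))"
      unfolding \<open>A * P = P * B\<close>
      using that carrier by (simp add: scalar_prod_def lessThan_atLeast0 mult.commute)
    finally show ?thesis .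
  qed
  have indep: "c l = 0" if c: "\<And>x. x < n \<Longrightarrow> (\<Sum>l<n. c l * P $$ (x, l)) = 0" and "l < n" for c l
  proof -
    have "P *\<^sub>v vec n c = 0\<^sub>v n"
      using carrier c by (intro eq_vecI) (simp_all add: scalar_prod_def lessThan_atLeast0 mult.commute)
    then have "Q * P *\<^sub>v vec n c = 0\<^sub>v n"
      using carrier by (simp add: assoc_mult_mat_vec[of _ n n]) (auto simp: scalar_prod_def)
    then have "vec n c = 0\<^sub>v n"
      by (simp add: QP)
    with \<open>l < n\<close> show ?thesis
      by (metis index_vec index_zero_vec(1))
  qed
  have diag: "B $$ (i, i) = of_real (es ! i)" if "i < n" for i
    using arg_cong[OF schur(3), of "\<lambda>xs. xs ! i"] that carrier es(1) by (simp add: diag_mat_def)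
  define eigen where "eigen = (\<lambda>i v c.
      (\<forall>x<n. v x = (\<Sum>l\<le>i. c l * P $$ (x, l))) \<and>
      (\<forall>m<i. (\<Sum>x<n. cnj (P $$ (x, m)) * v x) = 0) \<and> (\<Sum>x<n. cnj (v x) * v x) = 1 \<and>
      (\<forall>x<n. (\<Sum>y<n. A $$ (x, y) * v y) = of_real (es ! i) * v x))"
  have "\<exists>v c. eigen i v c" if "i < n" for i
  proof (rule eigenvector_from_triangular_flag[of n "\<lambda>x y. A $$ (x, y)" "\<lambda>x y. P $$ (x, y)"
          "\<lambda>x y. B $$ (x, y)" i])
    show "A $$ (x, y) = cnj (A $$ (y, x))" if "x < n" "y < n" for x y
      using hermitian_mat_index[OF assms(2) A that] by (simp only: conjugate_complex_def)
    show "B $$ (l, j) = 0" if "j < l" "l < n" for l j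
      using upper_triangularD[OF schur(2)] that carrier(1) by simp
  next
    fix c v
    assume "\<And>x. x < n \<Longrightarrow> v x = (\<Sum>l\<le>i. c l * P $$ (x, l))"
      "\<And>m. m < i \<Longrightarrow> (\<Sum>x<n. cnj (P $$ (x, m)) * v x) = 0" "(\<Sum>x<n. cnj (v x) * v x) = 1"
      "\<And>x. x < n \<Longrightarrow> (\<Sum>y<n. A $$ (x, y) * v y) = B $$ (i, i) * v x"
    then show ?thesis
      unfolding diag[OF that] eigen_def by blast
  qed (fact flag indep that)+
  then obtain v c where eigen: "\<And>i. i < n \<Longrightarrow> eigen i (v i) (c i)"
    by metis
  have v: "v i x = (\<Sum>l\<le>i. c i l * P $$ (x, l))" if "i < n" "x < n" for i x
    using eigen[unfolded eigen_def] that by blast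
  have orth: "(\<Sum>x<n. cnj (P $$ (x, m)) * v i x) = 0" if "i < n" "m < i" for i m
    using eigen[unfolded eigen_def] that by blast
  have unit: "(\<Sum>x<n. cnj (v i x) * v i x) = 1" if "i < n" for i
    using eigen[unfolded eigen_def] that by blast
  have ev: "(\<Sum>y<n. A $$ (x, y) * v i y) = of_real (es ! i) * v i x" if "x < n" "i < n" for x i
    using eigen[unfolded eigen_def] that by blast
  have orth_less: "(\<Sum>x<n. cnj (v i x) * v j x) = 0" if "i < j" "j < n" for i j
  proof -
    have "(\<Sum>x<n. cnj (v i x) * v j x) = (\<Sum>x<n. \<Sum>l\<le>i. cnj (c i l) * (cnj (P $$ (x, l)) * v j x))"
      using that by (intro sum.cong refl) (simp add: v[THEN arg_cong[of _ _ cnj]] sum_distrib_left mult_ac)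
    also have "\<dots> = (\<Sum>l\<le>i. cnj (c i l) * (\<Sum>x<n. cnj (P $$ (x, l)) * v j x))"
      unfolding sum_distrib_left by (rule sum.swap)
    also have "\<dots> = 0"
      using that orth by simp
    finally show ?thesis .
  qed
  have cols: "(\<Sum>x<n. cnj (v i x) * v j x) = (if i = j then 1 else 0)" if "i < n" "j < n" for i j
  proof (cases i j rule: linorder_cases)
    case greater
    have "(\<Sum>x<n. cnj (v i x) * v j x) = cnj (\<Sum>x<n. cnj (v j x) * v i x)"
      by (simp add: mult.commute)
    with greater orth_less[OF greater \<open>i < n\<close>] show ?thesis
      by simp
  qed (use orth_less unit that in auto)
  define U where "U = mat n n (\<lambda>(x, i). v i x)"
  define U' where "U' = mat n n (\<lambda>(i, x). cnj (v i x))"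
  have "U' * U = 1\<^sub>m n"
    by (rule eq_matI) (simp_all add: U_def U'_def scalar_prod_def cols flip: lessThan_atLeast0)
  then have "U * U' = 1\<^sub>m n"
    by (rule mat_mult_left_right_inverse[rotated 2]) (simp_all add: U_def U'_def)
  have rows: "(\<Sum>i<n. v i x * cnj (v i y)) = (if x = y then 1 else 0)" if "x < n" "y < n" for x y
  proof -
    have "(\<Sum>i<n. v i x * cnj (v i y)) = (U * U') $$ (x, y)"
      using that by (simp add: U_def U'_def scalar_prod_def lessThan_atLeast0)
    with that show ?thesis
      by (simp add: \<open>U * U' = 1\<^sub>m n\<close>)
  qed
  have "orthonormal_eigenbasis n A (\<lambda>i. es ! i) (\<lambda>x i. v i x)"
    unfolding orthonormal_eigenbasis_def using cols rows ev by blast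
  with es show thesis
    by (rule that)
qed

section \<open>Positive semidefinite matrices and their diagonal blocks\<close>

lemma psd_mats_quadratic_form:
  fixes A :: "'a::conjugatable_ordered_field mat"
  assumes "A \<in> psd_mats n"
  shows "0 \<le> (\<Sum>x<n. (\<Sum>y<n. A $$ (x, y) * v y) * conjugate (v x))"
proof -
  have "A \<in> carrier_mat n n" and "0 \<le> (A *\<^sub>v vec n v) \<bullet>c vec n v"
    using assms by (auto simp: psd_mats_def)
  then show ?thesis
    by (simp add: scalar_prod_def lessThan_atLeast0)
qed

lemma psd_matsI:
  fixes A :: "'a::conjugatable_ordered_field mat"
  assumes "A \<in> carrier_mat n n" "hermitian_mat A"
    and "\<And>v. 0 \<le> (\<Sum>x<n. (\<Sum>y<n. A $$ (x, y) * v y) * conjugate (v x))"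
  shows "A \<in> psd_mats n"
proof -
  have "0 \<le> (A *\<^sub>v v) \<bullet>c v" if "v \<in> carrier_vec n" for v
    using assms(1) assms(3)[of "\<lambda>x. v $ x"] that by (simp add: scalar_prod_def lessThan_atLeast0)
  with assms show ?thesis
    by (simp add: psd_mats_def)
qed

lemma psd_spectral_decomposition:
  fixes A :: "complex mat"
  assumes "A \<in> psd_mats n"
  obtains e :: "nat \<Rightarrow> real" and u :: "nat \<Rightarrow> nat \<Rightarrow> complex"
  where "orthonormal_eigenbasis n A e u" "\<forall>j. eigval (Suc j) A = (if j < n then e j else 0)"
    "\<forall>j<n. \<forall>i\<le>j. e j \<le> e i" "\<forall>i<n. 0 \<le> e i"
proof -
  have A: "A \<in> carrier_mat n n" "hermitian_mat A"
    using assms by (auto simp: psd_mats_def)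
  obtain es u where es: "length es = n" "sorted_wrt (\<ge>) es"
      "char_poly A = (\<Prod>e\<leftarrow>es. [:- of_real e, 1:])"
    and basis: "orthonormal_eigenbasis n A (\<lambda>i. es ! i) u"
    using hermitian_spectral_decomposition[OF A] by blast
  have "\<forall>j. eigval (Suc j) A = (if j < n then es ! j else 0)"
    using A(1) eigvals_decr_eqI[OF es(3,2)] by (simp add: eigval_def)
  moreover have "es ! j \<le> es ! i" if "i \<le> j" "j < n" for i j
    using that es(1) sorted_wrt_nth_less[OF es(2), of i j] by (cases "i = j") auto
  moreover have "0 \<le> es ! i" if "i < n" for i
  proof -
    have ev: "(\<Sum>y<n. A $$ (x, y) * u y i) = of_real (es ! i) * u x i" if "x < n" for x
      using basis \<open>i < n\<close> that unfolding orthonormal_eigenbasis_def by blast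
    have "(\<Sum>x<n. cnj (u x i) * u x i) = 1"
      using basis that unfolding orthonormal_eigenbasis_def by auto
    moreover have "(\<Sum>x<n. (\<Sum>y<n. A $$ (x, y) * u y i) * conjugate (u x i))
        = of_real (es ! i) * (\<Sum>x<n. cnj (u x i) * u x i)"
      by (simp add: ev sum_distrib_left mult.assoc) (simp add: mult_ac)
    ultimately show ?thesis
      using psd_mats_quadratic_form[OF assms, of "\<lambda>x. u x i"] by (simp add: less_eq_complex_def)
  qed
  ultimately show thesis
    using basis by (intro that[of "\<lambda>i. es ! i" u]) auto
qed

lemma block_index_less:
  assumes "s < \<beta>" "a < n"
  shows "s * n + a < \<beta> * (n :: nat)"
proof -
  have "s * n + a < Suc s * n"
    using assms(2) by simp
  also have "\<dots> \<le> \<beta> * n"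
    using assms(1) by (intro mult_le_mono1) simp
  finally show ?thesis .
qed

lemma sum_over_blocks: "(\<Sum>x<\<beta> * n. f x) = (\<Sum>s<\<beta>. \<Sum>a<n. f (s * n + a :: nat))"
proof -
  have "(\<Sum>x<\<beta> * n. f x) = (\<Sum>s<\<beta>. \<Sum>x=s * n..<s * n + n. f x)"
    by (rule sum.nat_group[symmetric])
  also have "\<dots> = (\<Sum>s<\<beta>. \<Sum>a<n. f (s * n + a))"
  proof (rule sum.cong[OF refl])
    fix s
    show "(\<Sum>x=s * n..<s * n + n. f x) = (\<Sum>a<n. f (s * n + a))"
      using sum.shift_bounds_nat_ivl[of f 0 "s * n" n] by (simp add: add.commute lessThan_atLeast0)
  qed
  finally show ?thesis .
qed

text \<open>
  The quadratic form of the sum at \<open>v\<close> is the sum over \<open>s\<close> of the form of \<open>H\<close> at the vector that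
  equals \<open>v\<close> on block \<open>s\<close> and vanishes elsewhere.
\<close>

lemma diag_block_sum_psd:
  fixes H :: "'a::conjugatable_ordered_field mat"
  assumes H: "H \<in> psd_mats (\<beta> * n)"
  shows "diag_block_sum \<beta> n H \<in> psd_mats n"
proof (rule psd_matsI)
  have carrier: "H \<in> carrier_mat (\<beta> * n) (\<beta> * n)" and herm: "hermitian_mat H"
    using H by (auto simp: psd_mats_def)
  show \<Delta>: "diag_block_sum \<beta> n H \<in> carrier_mat n n"
    by (simp add: diag_block_sum_def)
  have entry: "diag_block_sum \<beta> n H $$ (a, b) = (\<Sum>s<\<beta>. H $$ (s * n + a, s * n + b))"
    if "a < n" "b < n" for a b
    using that by (simp add: diag_block_sum_def block_def)
  show "hermitian_mat (diag_block_sum \<beta> n H)"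
  proof (rule hermitian_matI[OF \<Delta>])
    fix a b assume "a < n" "b < n"
    then have "H $$ (s * n + a, s * n + b) = conjugate (H $$ (s * n + b, s * n + a))" if "s < \<beta>" for s
      using that by (intro hermitian_mat_index[OF herm carrier] block_index_less)
    with \<open>a < n\<close> \<open>b < n\<close>
    show "diag_block_sum \<beta> n H $$ (a, b) = conjugate (diag_block_sum \<beta> n H $$ (b, a))"
      by (simp only: entry sum_conjugate finite_lessThan) simp
  qed
  show "0 \<le> (\<Sum>a<n. (\<Sum>b<n. diag_block_sum \<beta> n H $$ (a, b) * v b) * conjugate (v a))" for v
  proof -
    have "0 \<le> (\<Sum>a<n. (\<Sum>b<n. H $$ (s * n + a, s * n + b) * v b) * conjugate (v a))"
      if "s < \<beta>" for s
    proof -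
      define v' where "v' = (\<lambda>x. if x div n = s then v (x mod n) else 0)"
      have v': "v' (t * n + a) = (if t = s then v a else 0)" if "a < n" for t a
        using that by (simp add: v'_def)
      have inner: "(\<Sum>r<\<beta>. \<Sum>b<n. H $$ (x, r * n + b) * (if r = s then v b else 0))
          = (\<Sum>b<n. H $$ (x, s * n + b) * v b)" for x
      proof -
        have "(\<Sum>r<\<beta>. \<Sum>b<n. H $$ (x, r * n + b) * (if r = s then v b else 0))
            = (\<Sum>r<\<beta>. if r = s then \<Sum>b<n. H $$ (x, s * n + b) * v b else 0)"
          by (intro sum.cong refl) simp
        with that show ?thesis
          by simp
      qed
      have outer: "(\<Sum>t<\<beta>. \<Sum>a<n. f t a * conjugate (if t = s then v a else 0))
          = (\<Sum>a<n. f s a * conjugate (v a))" for f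
      proof -
        have "(\<Sum>t<\<beta>. \<Sum>a<n. f t a * conjugate (if t = s then v a else 0))
            = (\<Sum>t<\<beta>. if t = s then \<Sum>a<n. f s a * conjugate (v a) else 0)"
          by (intro sum.cong refl) simp
        with that show ?thesis
          by simp
      qed
      have "0 \<le> (\<Sum>x<\<beta> * n. (\<Sum>y<\<beta> * n. H $$ (x, y) * v' y) * conjugate (v' x))"
        by (rule psd_mats_quadratic_form[OF H])
      then show ?thesis
        by (simp add: sum_over_blocks v' inner outer)
    qed
    then have "0 \<le> (\<Sum>s<\<beta>. \<Sum>a<n. (\<Sum>b<n. H $$ (s * n + a, s * n + b) * v b) * conjugate (v a))"
      by (rule sum_nonneg) simp
    also have "\<dots> = (\<Sum>a<n. \<Sum>b<n. \<Sum>s<\<beta>. H $$ (s * n + a, s * n + b) * v b * conjugate (v a))"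
      by (simp only: sum_distrib_right sum.swap[of _ "{..<n}" "{..<\<beta>}"])
    finally show ?thesis
      by (simp add: entry sum_distrib_right)
  qed
qed

text \<open>
  The factorisation \<open>H = C\<^sup>* C\<close> is taken to be \<open>C = D\<^sup>1\<^sup>/\<^sup>2 U\<^sup>*\<close> with \<open>H = U D U\<^sup>*\<close> the spectral
  decomposition, since this makes \<open>C C\<^sup>* = D\<close> diagonal with ordered entries.
\<close>

lemma eigval_le_eigval_diag_block_sum:
  fixes H :: "complex mat"
  assumes "\<beta> \<le> 4" and H: "H \<in> psd_mats (\<beta> * n)"
    and blocks: "\<And>s t. s < \<beta> \<Longrightarrow> t < \<beta> \<Longrightarrow> hermitian_mat (block n H s t)"
    and "k < n"
  shows "eigval (1 + 4 * k) H \<le> eigval (1 + k) (diag_block_sum \<beta> n H)"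
proof -
  let ?N = "\<beta> * n" and ?\<Delta> = "diag_block_sum \<beta> n H"
  have carrier: "H \<in> carrier_mat ?N ?N" and herm: "hermitian_mat H"
    using H by (auto simp: psd_mats_def)
  obtain h u where basis_H: "orthonormal_eigenbasis ?N H h u"
    and h: "\<forall>j. eigval (Suc j) H = (if j < ?N then h j else 0)"
      "\<forall>j<?N. \<forall>i\<le>j. h j \<le> h i" "\<forall>i<?N. 0 \<le> h i"
    using psd_spectral_decomposition[OF H] by blast
  obtain d w where basis_\<Delta>: "orthonormal_eigenbasis n ?\<Delta> d w"
    and d: "\<forall>j. eigval (Suc j) ?\<Delta> = (if j < n then d j else 0)"
      "\<forall>j<n. \<forall>i\<le>j. d j \<le> d i" "\<forall>i<n. 0 \<le> d i"
    using psd_spectral_decomposition[OF diag_block_sum_psd[OF H]] by blast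
  have u: "(\<Sum>x<?N. cnj (u x i) * u x j) = (if i = j then 1 else 0)" if "i < ?N" "j < ?N" for i j
    using basis_H that unfolding orthonormal_eigenbasis_def by blast
  have w: "(\<Sum>i<n. w x i * cnj (w y i)) = (if x = y then 1 else 0)" if "x < n" "y < n" for x y
    using basis_\<Delta> that unfolding orthonormal_eigenbasis_def by blast
  note H_eq = orthonormal_eigenbasis_entry[OF basis_H]
  note \<Delta>_eq = orthonormal_eigenbasis_entry[OF basis_\<Delta>]
  show ?thesis
  proof (cases "4 * k < ?N")
    case False
    \<comment> \<open>\<open>\<lambda>\<^sub>1\<^sub>+\<^sub>4\<^sub>k(H) = 0\<close> by convention, and the eigenvalues of \<open>\<Delta>\<close> are nonnegative\<close>
    with h(1) d(1,3) \<open>k < n\<close> show ?thesis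
      by simp
  next
    case True
    define c where "c = (\<lambda>s i a. of_real (sqrt (h i)) * cnj (u (s * n + a) i))"
    have gram: "(\<Sum>i<?N. cnj (c s i a) * c t i b) = H $$ (s * n + a, t * n + b)"
      if "s < \<beta>" "t < \<beta>" "a < n" "b < n" for s t a b
    proof -
      have "cnj (c s i a) * c t i b = of_real (h i) * (u (s * n + a) i * cnj (u (t * n + b) i))"
        if "i < ?N" for i
      proof -
        have "cnj (c s i a) * c t i b
            = of_real (sqrt (h i)) * of_real (sqrt (h i)) * (u (s * n + a) i * cnj (u (t * n + b) i))"
          by (simp add: c_def mult_ac)
        moreover have "of_real (sqrt (h i)) * of_real (sqrt (h i)) = complex_of_real (h i)"
          using h(3) that by (simp flip: of_real_mult)
        ultimately show ?thesis
          by (simp only:)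
      qed
      with that show ?thesis
        by (simp add: H_eq block_index_less)
    qed
    have "\<exists>i<Suc (4 * k). h i \<le> d k"
    proof (rule partial_trace_eigenvalue_bound[where c = c and w = w and d = d and n = n and N = ?N])
      fix s t a b assume *: "s < \<beta>" "t < \<beta>" "a < n" "b < n"
      have "block n H s t $$ (a, b) = conjugate (block n H s t $$ (b, a))"
        using * by (intro hermitian_mat_index[OF blocks]) (auto simp: block_def)
      then have "H $$ (s * n + a, t * n + b) = conjugate (H $$ (s * n + b, t * n + a))"
        using * by (simp add: block_def)
      also have "\<dots> = H $$ (t * n + a, s * n + b)"
        using * by (intro hermitian_mat_index[OF herm carrier, symmetric] block_index_less)
      finally show "(\<Sum>i<?N. cnj (c s i a) * c t i b) = (\<Sum>i<?N. cnj (c t i a) * c s i b)"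
        using * by (simp add: gram)
    next
      fix a b assume *: "a < n" "b < n"
      then have "(\<Sum>s<\<beta>. \<Sum>i<?N. cnj (c s i a) * c s i b) = ?\<Delta> $$ (a, b)"
        by (simp add: gram diag_block_sum_def block_def)
      with * show "(\<Sum>s<\<beta>. \<Sum>i<?N. cnj (c s i a) * c s i b)
          = (\<Sum>j<n. of_real (d j) * (w a j * cnj (w b j)))"
        by (simp add: \<Delta>_eq)
    next
      fix i j assume *: "i < ?N" "j < ?N"
      have "(\<Sum>s<\<beta>. \<Sum>a<n. c s i a * cnj (c s j a))
          = of_real (sqrt (h i)) * of_real (sqrt (h j)) * (\<Sum>x<?N. cnj (u x i) * u x j)"
        by (simp add: sum_over_blocks c_def sum_distrib_left mult_ac)
      with * h(3) show "(\<Sum>s<\<beta>. \<Sum>a<n. c s i a * cnj (c s j a)) = (if i = j then of_real (h i) else 0)"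
        by (auto simp: u simp flip: of_real_mult)
    qed (use \<open>\<beta> \<le> 4\<close> w d \<open>k < n\<close> True in auto)
    then obtain i where "i \<le> 4 * k" "h i \<le> d k"
      by (auto simp: less_Suc_eq_le)
    with h(2) True have "h (4 * k) \<le> d k"
      by (meson order_trans)
    with h(1) d(1) True \<open>k < n\<close> show ?thesis
      by simp
  qed
qed

section \<open>From complex to real matrices\<close>

text \<open>
  For \<open>v = f + \<i> g\<close> with real \<open>f\<close> and \<open>g\<close>, symmetry of \<open>H\<close> cancels the mixed terms:
  \<open>v\<^sup>* H v = f\<^sup>T H f + g\<^sup>T H g\<close>.
\<close>

lemma map_mat_of_real_psd:
  fixes H :: "real mat"
  assumes "H \<in> psd_mats n"
  shows "map_mat complex_of_real H \<in> psd_mats n"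
proof (rule psd_matsI)
  have carrier: "H \<in> carrier_mat n n" and herm: "hermitian_mat H"
    using assms by (auto simp: psd_mats_def)
  have sym: "H $$ (x, y) = H $$ (y, x)" if "x < n" "y < n" for x y
    using hermitian_mat_index[OF herm carrier that] by simp
  show C: "map_mat complex_of_real H \<in> carrier_mat n n"
    using carrier by simp
  show "hermitian_mat (map_mat complex_of_real H)"
  proof (rule hermitian_matI[OF C])
    fix x y assume "x < n" "y < n"
    with carrier sym[of x y]
    show "map_mat complex_of_real H $$ (x, y) = conjugate (map_mat complex_of_real H $$ (y, x))"
      by auto
  qed
  fix v
  let ?q = "\<lambda>f g. \<Sum>x<n. (\<Sum>y<n. H $$ (x, y) * f y) * g x"
  define E where "E = (\<Sum>x<n. (\<Sum>y<n. map_mat complex_of_real H $$ (x, y) * v y) * conjugate (v x))"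
  have E: "E = (\<Sum>x<n. (\<Sum>y<n. of_real (H $$ (x, y)) * v y) * cnj (v x))"
    unfolding E_def using carrier by (intro sum.cong refl arg_cong2[where f = "(*)"]) auto
  have "Re E = ?q (\<lambda>x. Re (v x)) (\<lambda>x. Re (v x)) + ?q (\<lambda>x. Im (v x)) (\<lambda>x. Im (v x))"
    by (simp add: E sum.distrib)
  moreover have "Im E = ?q (\<lambda>x. Im (v x)) (\<lambda>x. Re (v x)) - ?q (\<lambda>x. Re (v x)) (\<lambda>x. Im (v x))"
    by (simp add: E sum.distrib sum_subtractf sum_negf)
  moreover have "?q (\<lambda>x. Im (v x)) (\<lambda>x. Re (v x)) = ?q (\<lambda>x. Re (v x)) (\<lambda>x. Im (v x))"
  proof -
    have "?q (\<lambda>x. Im (v x)) (\<lambda>x. Re (v x)) = (\<Sum>y<n. \<Sum>x<n. H $$ (x, y) * Im (v y) * Re (v x))"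
      unfolding sum_distrib_right by (rule sum.swap)
    also have "\<dots> = (\<Sum>y<n. \<Sum>x<n. H $$ (y, x) * Re (v x) * Im (v y))"
      by (intro sum.cong refl) (metis lessThan_iff mult.assoc mult.commute sym)
    finally show ?thesis
      by (simp add: sum_distrib_right)
  qed
  ultimately show "0 \<le> (\<Sum>x<n. (\<Sum>y<n. map_mat complex_of_real H $$ (x, y) * v y) * conjugate (v x))"
    unfolding E_def[symmetric]
    using psd_mats_quadratic_form[OF assms, of "\<lambda>x. Re (v x)"]
      psd_mats_quadratic_form[OF assms, of "\<lambda>x. Im (v x)"]
    by (simp add: less_eq_complex_def)
qed

lemma eigval_map_mat_of_real:
  fixes A :: "real mat"
  assumes "A \<in> psd_mats n"
  shows "eigval j (map_mat complex_of_real A) = eigval j A"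
proof -
  let ?C = "map_mat complex_of_real A"
  have A: "A \<in> carrier_mat n n"
    using assms by (simp add: psd_mats_def)
  have C: "?C \<in> carrier_mat n n" "hermitian_mat ?C"
    using map_mat_of_real_psd[OF assms] by (simp_all add: psd_mats_def)
  obtain es where es: "sorted_wrt (\<ge>) es" "char_poly ?C = (\<Prod>e\<leftarrow>es. [:- of_real e, 1:])"
    using hermitian_char_poly_real_roots[OF C] by blast
  have "map_poly complex_of_real (char_poly A) = char_poly ?C"
    by (rule of_real_hom.char_poly_hom[OF A, symmetric])
  also have "\<dots> = map_poly complex_of_real (\<Prod>e\<leftarrow>es. [:- e, 1:])"
  proof -
    interpret map_poly_comm_ring_hom complex_of_real ..
    show ?thesis
      unfolding es(2) by (simp add: hom_prod_list o_def map_poly_pCons)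
  qed
  finally have "char_poly A = (\<Prod>e\<leftarrow>es. [:- of_real e, 1:])"
    by (simp add: poly_eq_iff coeff_map_poly)
  then have "eigvals_decr A = es"
    using es(1) by (rule eigvals_decr_eqI)
  moreover have "eigvals_decr ?C = es"
    using es(2,1) by (rule eigvals_decr_eqI)
  ultimately show ?thesis
    by (simp add: eigval_def)
qed

theorem corollary3p3:
  fixes \<beta> n :: nat
  assumes "\<beta> \<in> {3, 4}"
  shows "(\<forall>H :: real mat. H \<in> psd_mats (\<beta> * n) \<longrightarrow>
            (\<forall>s<\<beta>. \<forall>t<\<beta>. hermitian_mat (block n H s t)) \<longrightarrow>
            (\<forall>k<n. eigval (1 + 4 * k) H \<le> eigval (1 + k) (diag_block_sum \<beta> n H)))
       \<and> (\<forall>H :: complex mat. H \<in> psd_mats (\<beta> * n) \<longrightarrow>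
            (\<forall>s<\<beta>. \<forall>t<\<beta>. hermitian_mat (block n H s t)) \<longrightarrow>
            (\<forall>k<n. eigval (1 + 4 * k) H \<le> eigval (1 + k) (diag_block_sum \<beta> n H)))"
proof (intro conjI allI impI)
  fix H :: "real mat" and k
  assume H: "H \<in> psd_mats (\<beta> * n)" and blocks: "\<forall>s<\<beta>. \<forall>t<\<beta>. hermitian_mat (block n H s t)"
    and "k < n"
  let ?C = "map_mat complex_of_real H"
  have carrier: "H \<in> carrier_mat (\<beta> * n) (\<beta> * n)"
    using H by (simp add: psd_mats_def)
  have block_C: "block n ?C s t = map_mat of_real (block n H s t)" if "s < \<beta>" "t < \<beta>" for s t
    using that carrier by (intro eq_matI) (auto simp: block_def block_index_less)
  have "hermitian_mat (block n ?C s t)" if "s < \<beta>" "t < \<beta>" for s t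
  proof (rule hermitian_matI)
    show "block n ?C s t \<in> carrier_mat n n"
      by (simp add: block_def)
    fix a b assume "a < n" "b < n"
    moreover from this have "block n H s t $$ (a, b) = conjugate (block n H s t $$ (b, a))"
      using blocks that by (intro hermitian_mat_index) (auto simp: block_def)
    ultimately show "block n ?C s t $$ (a, b) = conjugate (block n ?C s t $$ (b, a))"
      using that by (simp add: block_C) (simp add: block_def)
  qed
  then have le: "eigval (1 + 4 * k) ?C \<le> eigval (1 + k) (diag_block_sum \<beta> n ?C)"
    using assms \<open>k < n\<close> map_mat_of_real_psd[OF H]
    by (intro eigval_le_eigval_diag_block_sum) auto
  have \<Delta>: "diag_block_sum \<beta> n ?C = map_mat of_real (diag_block_sum \<beta> n H)"
    by (intro eq_matI) (auto simp: diag_block_sum_def block_C, auto simp: block_def)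
  show "eigval (1 + 4 * k) H \<le> eigval (1 + k) (diag_block_sum \<beta> n H)"
    using le diag_block_sum_psd[OF H] unfolding \<Delta>
    by (simp only: eigval_map_mat_of_real[OF H] eigval_map_mat_of_real)
next
  fix H :: "complex mat" and k
  assume "H \<in> psd_mats (\<beta> * n)" "\<forall>s<\<beta>. \<forall>t<\<beta>. hermitian_mat (block n H s t)" "k < n"
  with assms show "eigval (1 + 4 * k) H \<le> eigval (1 + k) (diag_block_sum \<beta> n H)"
    by (intro eigval_le_eigval_diag_block_sum) auto
qed

end
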